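(* Let $\pi$ and $\varphi$ be the $\mathcal{L}_{\mathrm{B}}$-sentences $$\pi:\ \forall a\,b\,p\,c\,c'\Bigl[\bigl(a\ne b\wedge\neg\operatorname{Coll}(a,b,p)\wedge c\ne p\wedge c'\ne p\wedge\neg\operatorname{Meets}(p,c;a,b)\wedge\neg\operatorname{Meets}(p,c';a,b)\bigr)\to\operatorname{Coll}(p,c,c')\Bigr],$$ $$\varphi:\ \exists a_1b_1a_2b_2\Bigl[a_1\ne b_1\wedge a_2\ne b_2\wedge\neg\operatorname{Meets}(a_1,b_1;a_2,b_2)\wedge\forall c\,d\Bigl(\bigl(c\ne d\wedge\neg(\operatorname{Coll}(a_1,b_1,c)\wedge\operatorname{Coll}(a_1,b_1,d))\wedge\neg(\operatorname{Coll}(a_2,b_2,c)\wedge\operatorname{Coll}(a_2,b_2,d))\bigr)\to\bigl(\operatorname{Meets}(c,d;a_1,b_1)\leftrightarrow\operatorname{Meets}(c,d;a_2,b_2)\bigr)\Bigr)\Bigr].$$ Let $D\subseteq\mathbb{R}^2$ be the open unit disk and $\Sigma_2=\{(x,y)\in\mathbb{R}^2:0<y<1\}$ the open planar strip (which is $\mathcal{L}_{\mathrm{B}}$-isomorphic to the open half-plane). Then $$\mathbb{R}^2\models\pi\wedge\varphi,\qquad\Sigma_2\models\neg\pi\wedge\varphi,\qquad D\models\neg\pi\wedge\neg\varphi.$$ Hence the plane, the strip (equivalently, the half-plane), and the open disk are pairwise elementarily inequivalent in $\mathcal{L}_{\mathrm{B}}$.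
   Context: $\mathcal{L}_{\mathrm{B}}$ is the first-order language with a single ternary relation symbol $B$. A convex set $K\subseteq\mathbb{R}^n$ is an $\mathcal{L}_{\mathrm{B}}$-structure with universe $K$, where $B(a,x,b)$ holds iff $x\in[a,b]$ (the closed segment). $\operatorname{Coll}(x,y,z):\equiv B(x,y,z)\vee B(y,x,z)\vee B(x,z,y)$, and $\operatorname{Meets}(a,b;c,d):\equiv\exists z\,(\operatorname{Coll}(a,b,z)\wedge\operatorname{Coll}(c,d,z))$. *)

theory Defs
  imports "HOL-Analysis.Analysis"
begin

section \<open>First-order formulas over one ternary relation symbol\<close>

datatype formula =
    FEq string string  (infix "\<^bold>=" 50)
  | FBetw string string string
  | FNot formula  ("\<^bold>\<not> _" [40] 40)
  | FAnd formula formula  (infixr "\<^bold>\<and>" 35)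
  | FOr formula formula  (infixr "\<^bold>\<or>" 30)
  | FImp formula formula  (infixr "\<^bold>\<longrightarrow>" 25)
  | FIff formula formula  (infixr "\<^bold>\<longleftrightarrow>" 25)
  | FAll string formula
  | FEx string formula

abbreviation FNeq :: "string \<Rightarrow> string \<Rightarrow> formula"  (infix "\<^bold>\<noteq>" 50)
  where "x \<^bold>\<noteq> y \<equiv> \<^bold>\<not> (x \<^bold>= y)"

primrec free_vars :: "formula \<Rightarrow> string set" where
  "free_vars (x \<^bold>= y) = {x, y}"
| "free_vars (FBetw x y z) = {x, y, z}"
| "free_vars (\<^bold>\<not> F) = free_vars F"
| "free_vars (F \<^bold>\<and> G) = free_vars F \<union> free_vars G"
| "free_vars (F \<^bold>\<or> G) = free_vars F \<union> free_vars G"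
| "free_vars (F \<^bold>\<longrightarrow> G) = free_vars F \<union> free_vars G"
| "free_vars (F \<^bold>\<longleftrightarrow> G) = free_vars F \<union> free_vars G"
| "free_vars (FAll x F) = free_vars F - {x}"
| "free_vars (FEx x F) = free_vars F - {x}"

definition sentence :: "formula \<Rightarrow> bool"
  where "sentence F \<longleftrightarrow> free_vars F = {}"

record 'a lb_structure =
  univ :: "'a set"
  betw :: "'a \<Rightarrow> 'a \<Rightarrow> 'a \<Rightarrow> bool"

primrec sat :: "'a lb_structure \<Rightarrow> (string \<Rightarrow> 'a) \<Rightarrow> formula \<Rightarrow> bool" where
  "sat M s (x \<^bold>= y) \<longleftrightarrow> s x = s y"
| "sat M s (FBetw x y z) \<longleftrightarrow> betw M (s x) (s y) (s z)"
| "sat M s (\<^bold>\<not> F) \<longleftrightarrow> \<not> sat M s F"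
| "sat M s (F \<^bold>\<and> G) \<longleftrightarrow> sat M s F \<and> sat M s G"
| "sat M s (F \<^bold>\<or> G) \<longleftrightarrow> sat M s F \<or> sat M s G"
| "sat M s (F \<^bold>\<longrightarrow> G) \<longleftrightarrow> (sat M s F \<longrightarrow> sat M s G)"
| "sat M s (F \<^bold>\<longleftrightarrow> G) \<longleftrightarrow> (sat M s F \<longleftrightarrow> sat M s G)"
| "sat M s (FAll x F) \<longleftrightarrow> (\<forall>u\<in>univ M. sat M (s(x := u)) F)"
| "sat M s (FEx x F) \<longleftrightarrow> (\<exists>u\<in>univ M. sat M (s(x := u)) F)"

definition models :: "'a lb_structure \<Rightarrow> formula \<Rightarrow> bool"  (infix "\<Turnstile>" 20)
  where "(M \<Turnstile> F) \<longleftrightarrow> (\<forall>s. (\<forall>v. s v \<in> univ M) \<longrightarrow> sat M s F)"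

definition elementarily_equivalent :: "'a lb_structure \<Rightarrow> 'b lb_structure \<Rightarrow> bool"
  where "elementarily_equivalent M N \<longleftrightarrow>
    (\<forall>F. sentence F \<longrightarrow> ((M \<Turnstile> F) \<longleftrightarrow> (N \<Turnstile> F)))"

definition lb_isomorphic :: "'a lb_structure \<Rightarrow> 'b lb_structure \<Rightarrow> bool"
  where "lb_isomorphic M N \<longleftrightarrow>
    (\<exists>f. bij_betw f (univ M) (univ N) \<and>
      (\<forall>a\<in>univ M. \<forall>x\<in>univ M. \<forall>b\<in>univ M. betw M a x b \<longleftrightarrow> betw N (f a) (f x) (f b)))"

section \<open>Convex sets as structures\<close>

text \<open>Only convex \<open>K\<close> are of interest. The relation is total on the ambient space, but its
  values outside \<open>K\<close> play no role, since quantifiers and assignments range over \<open>K\<close>.\<close>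

definition betw_structure :: "(real ^ 'n) set \<Rightarrow> (real ^ 'n) lb_structure"
  where "betw_structure K = \<lparr>univ = K, betw = (\<lambda>a x b. x \<in> closed_segment a b)\<rparr>"

definition open_unit_disk :: "(real ^ 2) set"
  where "open_unit_disk = ball 0 1"

definition open_strip :: "(real ^ 2) set"
  where "open_strip = {v. 0 < v $ 2 \<and> v $ 2 < 1}"

definition open_half_plane :: "(real ^ 2) set"
  where "open_half_plane = {v. 0 < v $ 2}"

lemma convex_universes:
  "convex open_unit_disk" "convex open_strip" "convex open_half_plane"
proof -
  show "convex open_unit_disk"
    by (simp add: open_unit_disk_def)
  show "convex open_half_plane"
    unfolding open_half_plane_def using convex_halfspace_gt[of 0 "axis 2 1 :: real ^ 2"]
    by (simp add: inner_axis inner_commute)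
  then have "convex (open_half_plane \<inter> {v. v $ 2 < 1})"
    using convex_halfspace_lt[of "axis 2 1 :: real ^ 2" 1]
    by (simp add: inner_axis inner_commute convex_Int)
  moreover have "open_half_plane \<inter> {v. v $ 2 < 1} = open_strip"
    by (auto simp: open_half_plane_def open_strip_def)
  ultimately show "convex open_strip"
    by simp
qed

section \<open>The sentences\<close>

definition Coll :: "string \<Rightarrow> string \<Rightarrow> string \<Rightarrow> formula"
  where "Coll x y z = (FBetw x y z \<^bold>\<or> FBetw y x z \<^bold>\<or> FBetw x z y)"

text \<open>The bound variable \<open>z\<close> of \<open>Meets\<close> must differ from the four arguments; the sentences
  below use it only in that way.\<close>

definition Meets :: "string \<Rightarrow> string \<Rightarrow> string \<Rightarrow> string \<Rightarrow> formula"
  where "Meets a b c d = FEx ''z'' (Coll a b ''z'' \<^bold>\<and> Coll c d ''z'')"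

definition pi_sentence :: formula where
  "pi_sentence =
    FAll ''a'' (FAll ''b'' (FAll ''p'' (FAll ''c'' (FAll ''c1'' (
      (''a'' \<^bold>\<noteq> ''b'' \<^bold>\<and> \<^bold>\<not> Coll ''a'' ''b'' ''p'' \<^bold>\<and> ''c'' \<^bold>\<noteq> ''p'' \<^bold>\<and> ''c1'' \<^bold>\<noteq> ''p''
        \<^bold>\<and> \<^bold>\<not> Meets ''p'' ''c'' ''a'' ''b'' \<^bold>\<and> \<^bold>\<not> Meets ''p'' ''c1'' ''a'' ''b'')
      \<^bold>\<longrightarrow> Coll ''p'' ''c'' ''c1'')))))"

definition phi_sentence :: formula where
  "phi_sentence =
    FEx ''a1'' (FEx ''b1'' (FEx ''a2'' (FEx ''b2'' (
      ''a1'' \<^bold>\<noteq> ''b1'' \<^bold>\<and> ''a2'' \<^bold>\<noteq> ''b2'' \<^bold>\<and> \<^bold>\<not> Meets ''a1'' ''b1'' ''a2'' ''b2''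
      \<^bold>\<and> FAll ''c'' (FAll ''d'' (
          (''c'' \<^bold>\<noteq> ''d''
            \<^bold>\<and> \<^bold>\<not> (Coll ''a1'' ''b1'' ''c'' \<^bold>\<and> Coll ''a1'' ''b1'' ''d'')
            \<^bold>\<and> \<^bold>\<not> (Coll ''a2'' ''b2'' ''c'' \<^bold>\<and> Coll ''a2'' ''b2'' ''d''))
          \<^bold>\<longrightarrow> (Meets ''c'' ''d'' ''a1'' ''b1'' \<^bold>\<longleftrightarrow> Meets ''c'' ''d'' ''a2'' ''b2'')))))))"

lemma sentence_pi_phi: "sentence pi_sentence" "sentence phi_sentence"
  by (auto simp: sentence_def pi_sentence_def phi_sentence_def Meets_def Coll_def)

end

theory Submission
  imports Defs
begin

text \<open>\<open>pi_sentence\<close> expresses uniqueness of parallels, and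
  \<open>phi_sentence\<close> asks for two disjoint lines such that every third line meets both or
  neither. In the plane, nonmeeting lines have proportional directions, so parallels are unique
  (\<open>models_pi_plane\<close>). In the strip and the disk a chord may be only a part of its
  Euclidean line; a line that would cross the missing part counts as nonmeeting, so uniqueness fails
  (\<open>not_models_pi_strip\<close>, \<open>not_models_pi_disk\<close>).

  Horizontal Euclidean lines lie wholly in the plane, and in the strip at heights between 0 and 1;
  exactly the nonhorizontal lines cross them, which gives \<open>phi_sentence\<close>
  (\<open>models_phi_horizontal_lines\<close>). In a bounded open set no line is complete: from a
  point of one of two disjoint lines one can aim at the missing part of the other
  (\<open>not_models_phi_bounded_open\<close>).

  So \<open>pi_sentence\<close> separates the plane from the rest, and \<open>phi_sentence\<close>
  separates the disk from the strip and the half-plane. The half-plane inherits its truth values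
  from the strip through a projective map (\<open>lb_isomorphic_strip_half_plane\<close>,
  \<open>lb_isomorphic_models_iff\<close>).\<close>

section \<open>The two sentences as geometric statements about K\<close>

text \<open>Semantic counterpart of \<open>Meets\<close>: collinearity is that of the ambient space,
  and only the meeting point is confined to \<open>K\<close>.\<close>

definition meets_in :: "(real ^ 'n) set \<Rightarrow> real ^ 'n \<Rightarrow> real ^ 'n \<Rightarrow> real ^ 'n \<Rightarrow> real ^ 'n \<Rightarrow> bool" where
  "meets_in K a b c d \<longleftrightarrow> (\<exists>z\<in>K. collinear {a, b, z} \<and> collinear {c, d, z})"

text \<open>The left side has the shape of \<open>Coll\<close> after unfolding, so the equivalence
  can rewrite it.\<close>

lemma collinear_iff_segments:
  fixes x y z :: "'a::euclidean_space"
  shows "(y \<in> closed_segment x z \<or> x \<in> closed_segment y z \<or> z \<in> closed_segment x y)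
    \<longleftrightarrow> collinear {x, y, z}"
  by (auto simp: collinear_between_cases between_mem_segment closed_segment_commute)

lemma models_pi_iff:
  fixes K :: "(real ^ 'n) set"
  assumes "K \<noteq> {}"
  shows "(betw_structure K \<Turnstile> pi_sentence) \<longleftrightarrow>
    (\<forall>a\<in>K. \<forall>b\<in>K. \<forall>p\<in>K. \<forall>c\<in>K. \<forall>c'\<in>K.
      a \<noteq> b \<and> \<not> collinear {a, b, p} \<and> c \<noteq> p \<and> c' \<noteq> p
        \<and> \<not> meets_in K p c a b \<and> \<not> meets_in K p c' a b
      \<longrightarrow> collinear {p, c, c'})"
proof -
  \<comment> \<open>\<open>models\<close> quantifies over assignments into \<open>K\<close>; once
    one exists, a closed formula no longer depends on it.\<close>
  have "\<exists>s :: string \<Rightarrow> real ^ 'n. \<forall>v. s v \<in> K"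
    using assms by auto
  then show ?thesis
    by (simp add: models_def pi_sentence_def Meets_def Coll_def betw_structure_def meets_in_def
        collinear_iff_segments)
qed

lemma not_models_piI:
  fixes K :: "(real ^ 'n) set"
  assumes "a \<in> K" "b \<in> K" "p \<in> K" "c \<in> K" "c' \<in> K"
    and "a \<noteq> b" "\<not> collinear {a, b, p}" "c \<noteq> p" "c' \<noteq> p"
    and "\<not> meets_in K p c a b" "\<not> meets_in K p c' a b"
    and "\<not> collinear {p, c, c'}"
  shows "\<not> (betw_structure K \<Turnstile> pi_sentence)"
proof
  assume *: "betw_structure K \<Turnstile> pi_sentence"
  have "K \<noteq> {}" using assms(1) by blast
  show False
    using *[unfolded models_pi_iff[OF \<open>K \<noteq> {}\<close>], rule_format, OF assms(1-5)] assms(6-12) by blast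
qed

text \<open>Over an empty universe there are no assignments and \<open>models\<close> holds
  vacuously, whereas an existential statement fails; hence the nonemptiness.\<close>

lemma models_phi_iff:
  fixes K :: "(real ^ 'n) set"
  assumes "K \<noteq> {}"
  shows "(betw_structure K \<Turnstile> phi_sentence) \<longleftrightarrow>
    (\<exists>a\<in>K. \<exists>b\<in>K. \<exists>a'\<in>K. \<exists>b'\<in>K.
      a \<noteq> b \<and> a' \<noteq> b' \<and> \<not> meets_in K a b a' b' \<and>
      (\<forall>c\<in>K. \<forall>d\<in>K. c \<noteq> d \<and> \<not> (collinear {a, b, c} \<and> collinear {a, b, d})
          \<and> \<not> (collinear {a', b', c} \<and> collinear {a', b', d})
        \<longrightarrow> (meets_in K c d a b \<longleftrightarrow> meets_in K c d a' b')))"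
proof -
  have "\<exists>s :: string \<Rightarrow> real ^ 'n. \<forall>v. s v \<in> K"
    using assms by auto
  then show ?thesis
    by (simp add: models_def phi_sentence_def Meets_def Coll_def betw_structure_def meets_in_def
        collinear_iff_segments)
qed

section \<open>Satisfaction of sentences and invariance under isomorphism\<close>

lemma models_conj: "(M \<Turnstile> F \<^bold>\<and> G) \<longleftrightarrow> (M \<Turnstile> F) \<and> (M \<Turnstile> G)"
  by (auto simp: models_def)

text \<open>The coincidence lemma. The assignments are generalised because the quantifier cases
  update both of them.\<close>

lemma sat_cong_free_vars:
  assumes "\<forall>v\<in>free_vars F. s v = t v"
  shows "sat M s F \<longleftrightarrow> sat M t F"
  using assms
proof (induction F arbitrary: s t)
  case (FAll x F)
  have "sat M (s(x := u)) F \<longleftrightarrow> sat M (t(x := u)) F" for u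
    by (rule FAll.IH) (use FAll.prems in auto)
  then show ?case by simp
next
  case (FEx x F)
  have "sat M (s(x := u)) F \<longleftrightarrow> sat M (t(x := u)) F" for u
    by (rule FEx.IH) (use FEx.prems in auto)
  then show ?case by simp
qed (simp_all add: ball_Un, blast+)

lemma models_iff_sat:
  assumes "sentence F" "\<And>v. s v \<in> univ M"
  shows "(M \<Turnstile> F) \<longleftrightarrow> sat M s F"
proof -
  have "sat M t F \<longleftrightarrow> sat M s F" for t
    by (rule sat_cong_free_vars) (use assms(1) in \<open>simp add: sentence_def\<close>)
  with assms(2) show ?thesis
    unfolding models_def by blast
qed

text \<open>A single assignment decides a sentence, and negation commutes with
  \<open>sat\<close>.\<close>

lemma models_not_sentence:
  assumes "sentence F" "univ M \<noteq> {}"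
  shows "(M \<Turnstile> \<^bold>\<not> F) \<longleftrightarrow> \<not> (M \<Turnstile> F)"
proof -
  obtain u where "u \<in> univ M" using assms(2) by auto
  moreover have "sentence (\<^bold>\<not> F)"
    using assms(1) by (simp add: sentence_def)
  ultimately show ?thesis
    using assms(1) models_iff_sat[where s = "\<lambda>_. u"] by simp
qed

text \<open>Injectivity of \<open>f\<close> handles equality; surjectivity lets the quantifiers over
  \<open>univ N\<close> range over images of points of \<open>univ M\<close>.\<close>

lemma sat_isomorphism:
  assumes f: "bij_betw f (univ M) (univ N)"
    and B: "\<And>a x b. \<lbrakk>a \<in> univ M; x \<in> univ M; b \<in> univ M\<rbrakk> \<Longrightarrow>
      betw M a x b \<longleftrightarrow> betw N (f a) (f x) (f b)"
    and s: "\<And>v. s v \<in> univ M"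
  shows "sat M s F \<longleftrightarrow> sat N (f \<circ> s) F"
  using s
proof (induction F arbitrary: s)
  case (FEq x y)
  then show ?case
    using f by (auto simp: bij_betw_def inj_on_def)
next
  case (FBetw x y z)
  then show ?case
    using B by simp
next
  case (FAll x F)
  have "sat M (s(x := u)) F \<longleftrightarrow> sat N ((f \<circ> s)(x := f u)) F" if "u \<in> univ M" for u
    unfolding fun_upd_comp[symmetric] by (rule FAll.IH) (use FAll.prems that in simp)
  then show ?case
    unfolding sat.simps bij_betw_imp_surj_on[OF f, symmetric] by simp
next
  case (FEx x F)
  have "sat M (s(x := u)) F \<longleftrightarrow> sat N ((f \<circ> s)(x := f u)) F" if "u \<in> univ M" for u
    unfolding fun_upd_comp[symmetric] by (rule FEx.IH) (use FEx.prems that in simp)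
  then show ?case
    unfolding sat.simps bij_betw_imp_surj_on[OF f, symmetric] by simp
qed simp_all

lemma lb_isomorphic_models_iff:
  assumes "lb_isomorphic M N" "sentence F" "univ M \<noteq> {}"
  shows "(M \<Turnstile> F) \<longleftrightarrow> (N \<Turnstile> F)"
proof -
  obtain f where f: "bij_betw f (univ M) (univ N)"
    and B: "\<And>a x b. \<lbrakk>a \<in> univ M; x \<in> univ M; b \<in> univ M\<rbrakk> \<Longrightarrow>
      betw M a x b \<longleftrightarrow> betw N (f a) (f x) (f b)"
    using assms(1) unfolding lb_isomorphic_def by blast
  obtain u where u: "u \<in> univ M" using assms(3) by auto
  then have fu: "f u \<in> univ N"
    using f by (auto simp: bij_betw_def)
  have "(M \<Turnstile> F) \<longleftrightarrow> sat M (\<lambda>_. u) F"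
    using assms(2) u by (rule models_iff_sat)
  also have "\<dots> \<longleftrightarrow> sat N (f \<circ> (\<lambda>_. u)) F"
    by (rule sat_isomorphism[OF f B]) (use u in auto)
  also have "\<dots> \<longleftrightarrow> (N \<Turnstile> F)"
    by (rule models_iff_sat[symmetric]) (use assms(2) fu in auto)
  finally show ?thesis .
qed

section \<open>Uniqueness of parallels in the plane\<close>

text \<open>This is the vanishing of the determinant of \<open>b - a\<close> and
  \<open>c - a\<close>, which turns planar incidence into real arithmetic.\<close>

lemma collinear_iff_det:
  fixes a b c :: "real ^ 2"
  shows "collinear {a, b, c} \<longleftrightarrow>
    (b $ 1 - a $ 1) * (c $ 2 - a $ 2) = (b $ 2 - a $ 2) * (c $ 1 - a $ 1)"
proof (cases "a = b")
  case False
  then have ne: "b $ 1 \<noteq> a $ 1 \<or> b $ 2 \<noteq> a $ 2"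
    by (auto simp: vec_eq_iff forall_2)
  have "collinear {a, b, c} \<longleftrightarrow> collinear {b, a, c}"
    by (simp add: insert_commute)
  also have "\<dots> \<longleftrightarrow> collinear {0, b - a, c - a}"
    by (rule collinear_3) simp
  also have "\<dots> \<longleftrightarrow> (\<exists>t. c - a = t *\<^sub>R (b - a))"
    using False by (auto simp: collinear_lemma intro: exI[of _ 0])
  also have "\<dots> \<longleftrightarrow> (\<exists>t. c $ 1 - a $ 1 = t * (b $ 1 - a $ 1) \<and> c $ 2 - a $ 2 = t * (b $ 2 - a $ 2))"
    by (simp add: vec_eq_iff forall_2)
  also have "\<dots> \<longleftrightarrow> (b $ 1 - a $ 1) * (c $ 2 - a $ 2) = (b $ 2 - a $ 2) * (c $ 1 - a $ 1)"
    (is "?L \<longleftrightarrow> ?R")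
  proof
    assume ?R
    show ?L
    \<comment> \<open>The parameter can be read off any coordinate in which \<open>b - a\<close>
      does not vanish.\<close>
    proof (cases "b $ 1 = a $ 1")
      case True
      with ne \<open>?R\<close> show ?thesis
        by (intro exI[of _ "(c $ 2 - a $ 2) / (b $ 2 - a $ 2)"]) auto
    next
      case False
      with \<open>?R\<close> show ?thesis
        by (intro exI[of _ "(c $ 1 - a $ 1) / (b $ 1 - a $ 1)"]) (auto simp: field_simps)
    qed
  qed auto
  finally show ?thesis .
qed simp

text \<open>Lines that do not meet have dependent directions, so \<open>c - p\<close> and
  \<open>c' - p\<close> are both multiples of the nonzero vector \<open>b - a\<close>, and hence
  dependent on each other.\<close>

lemma models_pi_plane: "betw_structure (UNIV :: (real ^ 2) set) \<Turnstile> pi_sentence"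
proof -
  have parallel: "(b $ 1 - a $ 1) * (c $ 2 - p $ 2) = (b $ 2 - a $ 2) * (c $ 1 - p $ 1)"
    if "\<not> meets_in UNIV p c a b" for a b p c :: "real ^ 2"
  proof (rule ccontr)
    \<comment> \<open>\<open>D\<close> is the determinant of the two directions, and
      \<open>t\<close> is Cramer's solution for the point of the line \<open>ab\<close> that lies on
      \<open>pc\<close>.\<close>
    define D where "D = (b $ 1 - a $ 1) * (c $ 2 - p $ 2) - (b $ 2 - a $ 2) * (c $ 1 - p $ 1)"
    define t where "t = ((p $ 1 - a $ 1) * (c $ 2 - p $ 2) - (p $ 2 - a $ 2) * (c $ 1 - p $ 1)) / D"
    assume "\<not> ?thesis"
    then have "D \<noteq> 0" by (simp add: D_def)
    then have t: "t * D = (p $ 1 - a $ 1) * (c $ 2 - p $ 2) - (p $ 2 - a $ 2) * (c $ 1 - p $ 1)"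
      by (simp add: t_def)
    have "collinear {a, b, a + t *\<^sub>R (b - a)}" "collinear {p, c, a + t *\<^sub>R (b - a)}"
      using t by (simp_all add: collinear_iff_det D_def algebra_simps)
    with that show False
      by (auto simp: meets_in_def)
  qed
  have "collinear {p, c, c'}"
    if "a \<noteq> b" "\<not> meets_in UNIV p c a b" "\<not> meets_in UNIV p c' a b"
    for a b p c c' :: "real ^ 2"
  proof -
    have cross: "c1 * d2 = c2 * d1" if "b1 \<noteq> 0 \<or> b2 \<noteq> 0" "b1 * c2 = b2 * c1" "b1 * d2 = b2 * d1"
      for b1 b2 c1 c2 d1 d2 :: real
      using that by algebra
    have ne: "b $ 1 - a $ 1 \<noteq> 0 \<or> b $ 2 - a $ 2 \<noteq> 0"
      using \<open>a \<noteq> b\<close> by (auto simp: vec_eq_iff forall_2)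
    show ?thesis
      unfolding collinear_iff_det
      by (rule cross[OF ne parallel[OF that(2)] parallel[OF that(3)]])
  qed
  then show ?thesis
    by (auto simp: models_pi_iff)
qed

section \<open>Lines met by the same lines: horizontal lines and bounded open sets\<close>

lemma collinear_of_common_line:
  assumes "p \<noteq> q" "collinear {p, q, x}" "collinear {p, q, y}" "collinear {p, q, z}"
  shows "collinear {x, y, z}"
proof (rule collinear_subset)
  show "collinear {p, q, x, y, z}"
    using assms by (subst collinear_triples) auto
qed auto

text \<open>A full horizontal line is met by exactly the nonhorizontal lines, so any two of them
  witness \<open>phi_sentence\<close>.\<close>

lemma models_phi_horizontal_lines:
  fixes K :: "(real ^ 2) set"
  assumes "h \<noteq> k" "{v. v $ 2 = h} \<subseteq> K" "{v. v $ 2 = k} \<subseteq> K"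
  shows "betw_structure K \<Turnstile> phi_sentence"
proof -
  have on_line: "collinear {vector [0, l], vector [1, l], z} \<longleftrightarrow> z $ 2 = l"
    for l and z :: "real ^ 2"
    by (simp add: collinear_iff_det)
  \<comment> \<open>The right-hand side does not mention \<open>l\<close>, so the instances for
    \<open>h\<close> and \<open>k\<close> together give the equivalence required by
    \<open>phi_sentence\<close>.\<close>
  have meets: "meets_in K c d (vector [0, l]) (vector [1, l]) \<longleftrightarrow> c $ 2 \<noteq> d $ 2"
    if sub: "{v. v $ 2 = l} \<subseteq> K" and cd: "c \<noteq> d" "\<not> (c $ 2 = l \<and> d $ 2 = l)" for l c d
  proof
    assume "meets_in K c d (vector [0, l]) (vector [1, l])"
    then obtain z where "collinear {c, d, z}" "z $ 2 = l"
      by (auto simp: meets_in_def on_line)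
    with cd show "c $ 2 \<noteq> d $ 2"
      by (auto simp: collinear_iff_det vec_eq_iff forall_2)
  next
    assume ne: "c $ 2 \<noteq> d $ 2"
    \<comment> \<open>The point of the line \<open>cd\<close> at height \<open>l\<close>.\<close>
    define z :: "real ^ 2" where
      "z = vector [c $ 1 + (l - c $ 2) * (d $ 1 - c $ 1) / (d $ 2 - c $ 2), l]"
    have "collinear {c, d, z}"
      using ne by (simp add: z_def collinear_iff_det)
    moreover have "z $ 2 = l" by (simp add: z_def)
    ultimately show "meets_in K c d (vector [0, l]) (vector [1, l])"
      using sub by (auto simp: meets_in_def on_line)
  qed
  have ne: "vector [0, l] \<noteq> (vector [1, l] :: real ^ 2)" for l
    by (simp add: vec_eq_iff forall_2)
  have inK: "vector [x, h] \<in> K" "vector [x, k] \<in> K" for x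
    using assms by auto
  have "\<not> meets_in K (vector [0, h]) (vector [1, h]) (vector [0, k]) (vector [1, k])"
    using assms(1) by (auto simp: meets_in_def on_line)
  moreover have "K \<noteq> {}" using inK by blast
  moreover have "meets_in K c d (vector [0, h]) (vector [1, h])
      \<longleftrightarrow> meets_in K c d (vector [0, k]) (vector [1, k])"
    if "c \<noteq> d \<and> \<not> (c $ 2 = h \<and> d $ 2 = h) \<and> \<not> (c $ 2 = k \<and> d $ 2 = k)" for c d
    using that meets[OF assms(2), of c d] meets[OF assms(3), of c d] by argo
  ultimately show ?thesis
    unfolding models_phi_iff[OF \<open>K \<noteq> {}\<close>]
    by (intro bexI[OF bexI[OF bexI[OF bexI[OF _ inK(2)[of 1]] inK(2)[of 0]] inK(1)[of 1]] inK(1)[of 0]]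
        conjI ballI impI)
      (simp_all only: on_line ne not_False_eq_True)
qed

text \<open>The secant through \<open>a\<close> and a point of the line \<open>a'b'\<close> outside \<open>K\<close> meets \<open>ab\<close> but not
  \<open>a'b'\<close> in \<open>K\<close>. At most one of the points of \<open>a'b'\<close> outside \<open>K\<close> gives back the line \<open>ab\<close>.\<close>

lemma not_models_phi_bounded_open:
  fixes K :: "(real ^ 'n) set"
  assumes "open K" "bounded K" "K \<noteq> {}"
  shows "\<not> (betw_structure K \<Turnstile> phi_sentence)"
proof
  assume "betw_structure K \<Turnstile> phi_sentence"
  then obtain a b a' b' where in_K: "a \<in> K" "b \<in> K" "a' \<in> K" "b' \<in> K"
    and *: "a \<noteq> b \<and> a' \<noteq> b' \<and> \<not> meets_in K a b a' b' \<and>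
      (\<forall>c\<in>K. \<forall>d\<in>K. c \<noteq> d \<and> \<not> (collinear {a, b, c} \<and> collinear {a, b, d})
          \<and> \<not> (collinear {a', b', c} \<and> collinear {a', b', d})
        \<longrightarrow> (meets_in K c d a b \<longleftrightarrow> meets_in K c d a' b'))"
    unfolding models_phi_iff[OF assms(3)] by (elim bexE)
  from * have ne: "a \<noteq> b" "a' \<noteq> b'" and disj: "\<not> meets_in K a b a' b'"
    by simp_all
  \<comment> \<open>Otherwise \<open>a\<close> itself would be a meeting point in
    \<open>K\<close>.\<close>
  have a: "\<not> collinear {a', b', a}"
    using disj in_K by (auto simp: meets_in_def insert_commute)
  obtain R where R: "\<And>x. x \<in> K \<Longrightarrow> norm x \<le> R"
    using assms(2) by (auto simp: bounded_iff)
  \<comment> \<open>Chosen so that, for \<open>t\<close> at least \<open>T\<close>, the point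
    \<open>a' + t (b' - a')\<close> has norm at least \<open>R + 1\<close>, beyond the bound for
    \<open>K\<close>.\<close>
  define T where "T = (R + norm a' + 1) / norm (b' - a')"
  have "R \<ge> 0" using R[OF in_K(1)] norm_ge_zero[of a] by linarith
  then have "T > 0" using ne by (auto simp: T_def intro!: divide_pos_pos add_nonneg_pos)
  define e where "e t = a' + t *\<^sub>R (b' - a')" for t
  have e_line: "collinear {a', b', e t}" for t
  proof -
    have "collinear {b', a', e t} \<longleftrightarrow> collinear {0, b' - a', e t - a'}"
      by (rule collinear_3) simp
    also have "\<dots>" by (auto simp: e_def collinear_lemma)
    finally show ?thesis by (simp add: insert_commute)
  qed
  have e_out: "e t \<notin> K" if "t \<ge> T" for t
  proof
    assume "e t \<in> K"
    then have "norm (a' + t *\<^sub>R (b' - a')) \<le> R" using R by (simp add: e_def)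
    moreover have "norm (t *\<^sub>R (b' - a')) \<le> norm (a' + t *\<^sub>R (b' - a')) + norm a'"
      by (metis add.commute add_diff_cancel_left' norm_triangle_ineq4)
    moreover have "norm (t *\<^sub>R (b' - a')) \<ge> T * norm (b' - a')"
      using that \<open>T > 0\<close> by (simp add: mult_right_mono)
    moreover have "T * norm (b' - a') = R + norm a' + 1"
      using ne by (simp add: T_def)
    ultimately show False by linarith
  qed
  have "e T \<noteq> e (2 * T)"
    using ne \<open>T > 0\<close> by (simp add: e_def)
  \<comment> \<open>Two distinct common points would make the lines \<open>ab\<close> and
    \<open>a'b'\<close> coincide, putting \<open>a\<close> on \<open>a'b'\<close>. So one of the two
    exterior points is off \<open>ab\<close>.\<close>
  have "\<not> (collinear {a, b, e T} \<and> collinear {a, b, e (2 * T)})"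
  proof
    assume *: "collinear {a, b, e T} \<and> collinear {a, b, e (2 * T)}"
    have on_e: "collinear {e T, e (2 * T), x}" if "collinear {p, q, e T}" "collinear {p, q, e (2 * T)}"
      "p \<noteq> q" "collinear {p, q, x}" for p q x
      using collinear_of_common_line[OF that(3,1,2,4)] .
    have "collinear {a', b', a}"
      by (rule collinear_of_common_line[OF \<open>e T \<noteq> e (2 * T)\<close>])
        (use on_e[of a' b'] on_e[of a b a] * ne e_line in \<open>simp_all add: insert_commute\<close>)
    then show False using a by simp
  qed
  then obtain t where t: "t \<ge> T" "\<not> collinear {a, b, e t}"
    using \<open>T > 0\<close> by (metis le_add_same_cancel1 less_imp_le mult_2 order_refl)
  define x where "x = e t"
  have x: "x \<notin> K" "\<not> collinear {a, b, x}" "collinear {a', b', x}"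
    using t e_out e_line by (auto simp: x_def)
  then have "a \<noteq> x" using in_K by auto
  obtain r where r: "r > 0" "ball a r \<subseteq> K"
    using assms(1) in_K(1) by (auto simp: open_contains_ball)
  \<comment> \<open>Puts \<open>d\<close> at distance \<open>r / 2\<close> from \<open>a\<close>
    towards \<open>x\<close>, hence inside the ball.\<close>
  define \<epsilon> where "\<epsilon> = r / (2 * norm (x - a))"
  define d where "d = a + \<epsilon> *\<^sub>R (x - a)"
  have "\<epsilon> > 0" using r \<open>a \<noteq> x\<close> by (simp add: \<epsilon>_def)
  have "d \<in> K"
    using r \<open>a \<noteq> x\<close> by (intro subsetD[OF r(2)]) (simp add: d_def dist_norm \<epsilon>_def)
  have "d \<noteq> a" using \<open>\<epsilon> > 0\<close> \<open>a \<noteq> x\<close> by (simp add: d_def)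
  have adx: "collinear {a, d, x}"
  proof -
    have "collinear {x, a, d} \<longleftrightarrow> collinear {0, x - a, d - a}"
      by (rule collinear_3) simp
    also have "\<dots>" by (auto simp: d_def collinear_lemma)
    finally show ?thesis by (simp add: insert_commute)
  qed
  have "\<not> collinear {a, b, d}"
    using collinear_of_common_line[of a d a b x] adx x(2) \<open>d \<noteq> a\<close> by (auto simp: insert_commute)
  \<comment> \<open>The line \<open>ad\<close> is neither of the two given ones: \<open>d\<close> is
    off \<open>ab\<close> and \<open>a\<close> is off \<open>a'b'\<close>.\<close>
  with * a \<open>d \<noteq> a\<close> in_K(1) \<open>d \<in> K\<close> have "meets_in K a d a b \<longleftrightarrow> meets_in K a d a' b'"
    by metis
  moreover have "meets_in K a d a b"
    unfolding meets_in_def by (rule bexI[OF _ in_K(1)]) (simp add: insert_commute)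
  ultimately obtain z where z: "z \<in> K" "collinear {a, d, z}" "collinear {a', b', z}"
    by (auto simp: meets_in_def)
  \<comment> \<open>Both \<open>ad\<close> and \<open>a'b'\<close> now contain the distinct points
    \<open>z\<close> and \<open>x\<close>, so they coincide, contradicting that \<open>a\<close> is
    off \<open>a'b'\<close>.\<close>
  have "z \<noteq> x" using z x by auto
  have "collinear {z, x, a}"
    by (rule collinear_of_common_line[of a d]) (use z adx \<open>d \<noteq> a\<close> in \<open>auto simp: insert_commute\<close>)
  moreover have "collinear {z, x, a'}" "collinear {z, x, b'}"
    by (rule collinear_of_common_line[of a' b']; use z x ne in \<open>simp add: insert_commute\<close>)+
  ultimately have "collinear {a', b', a}"
    by (rule collinear_of_common_line[OF \<open>z \<noteq> x\<close>, rotated 2])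
  then show False using a by simp
qed

section \<open>Several parallels through a point in the strip and in the disk\<close>

text \<open>The lines of slope 1 and -1 through \<open>?p\<close> reach the vertical axis at heights
  -1/2 and 3/2, on either side of the strip.\<close>

lemma not_models_pi_strip: "\<not> (betw_structure open_strip \<Turnstile> pi_sentence)"
proof (rule not_models_piI)
  let ?a = "vector [0, 1/4] :: real ^ 2" and ?b = "vector [0, 3/4] :: real ^ 2"
    and ?p = "vector [1, 1/2] :: real ^ 2"
    and ?c = "vector [5/4, 3/4] :: real ^ 2" and ?c' = "vector [5/4, 1/4] :: real ^ 2"
  show "?a \<in> open_strip" "?b \<in> open_strip" "?p \<in> open_strip" "?c \<in> open_strip" "?c' \<in> open_strip"
    by (simp_all add: open_strip_def)
  show "?a \<noteq> ?b" "?c \<noteq> ?p" "?c' \<noteq> ?p"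
    by (simp_all add: vec_eq_iff forall_2)
  show "\<not> collinear {?a, ?b, ?p}" "\<not> collinear {?p, ?c, ?c'}"
    by (simp_all add: collinear_iff_det)
  show "\<not> meets_in open_strip ?p ?c ?a ?b"
  proof
    assume "meets_in open_strip ?p ?c ?a ?b"
    then obtain z :: "real ^ 2" where "0 < z $ 2" "z $ 2 - 1/2 = z $ 1 - 1" "z $ 1 = 0"
      by (auto simp: meets_in_def collinear_iff_det open_strip_def)
    then show False by linarith
  qed
  show "\<not> meets_in open_strip ?p ?c' ?a ?b"
  proof
    assume "meets_in open_strip ?p ?c' ?a ?b"
    then obtain z :: "real ^ 2" where "z $ 2 < 1" "z $ 2 - 1/2 = 1 - z $ 1" "z $ 1 = 0"
      by (auto simp: meets_in_def collinear_iff_det open_strip_def)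
    then show False by linarith
  qed
qed

lemma mem_open_unit_disk: "v \<in> open_unit_disk \<longleftrightarrow> (v $ 1)\<^sup>2 + (v $ 2)\<^sup>2 < 1"
  by (simp add: open_unit_disk_def norm_vec_def L2_set_def UNIV_2)

text \<open>Against the horizontal diameter, one line through \<open>?p\<close> is horizontal and
  the other, of slope 1/4, crosses the axis only at (-2, 0), outside the disk.\<close>

lemma not_models_pi_disk: "\<not> (betw_structure open_unit_disk \<Turnstile> pi_sentence)"
proof (rule not_models_piI)
  let ?a = "vector [0, 0] :: real ^ 2" and ?b = "vector [1/2, 0] :: real ^ 2"
    and ?p = "vector [0, 1/2] :: real ^ 2"
    and ?c = "vector [1/2, 1/2] :: real ^ 2" and ?c' = "vector [1/2, 5/8] :: real ^ 2"
  show "?a \<in> open_unit_disk" "?b \<in> open_unit_disk" "?p \<in> open_unit_disk"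
    "?c \<in> open_unit_disk" "?c' \<in> open_unit_disk"
    by (simp_all add: mem_open_unit_disk power2_eq_square)
  show "?a \<noteq> ?b" "?c \<noteq> ?p" "?c' \<noteq> ?p"
    by (simp_all add: vec_eq_iff forall_2)
  show "\<not> collinear {?a, ?b, ?p}" "\<not> collinear {?p, ?c, ?c'}"
    by (simp_all add: collinear_iff_det)
  show "\<not> meets_in open_unit_disk ?p ?c ?a ?b"
  proof
    assume "meets_in open_unit_disk ?p ?c ?a ?b"
    then obtain z :: "real ^ 2" where "z $ 2 - 1/2 = 0" "z $ 2 = 0"
      by (auto simp: meets_in_def collinear_iff_det)
    then show False by linarith
  qed
  show "\<not> meets_in open_unit_disk ?p ?c' ?a ?b"
  proof
    assume "meets_in open_unit_disk ?p ?c' ?a ?b"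
    then obtain z where z: "z \<in> open_unit_disk" "(z $ 2 - 1/2) / 2 = z $ 1 / 8" "z $ 2 = 0"
      by (auto simp: meets_in_def collinear_iff_det)
    then have "z $ 1 = - 2" by simp
    with z show False
      by (simp add: mem_open_unit_disk)
  qed
qed

section \<open>The projective isomorphism from the strip to the half-plane\<close>

text \<open>For \<open>k = 1\<close> this projective map takes the strip to the half-plane, and \<open>k = -1\<close> gives its inverse.\<close>

definition persp :: "real \<Rightarrow> real ^ 2 \<Rightarrow> real ^ 2" where
  "persp k v = (1 / (1 - k * v $ 2)) *\<^sub>R v"

lemma persp_inverse:
  assumes "1 - k * v $ 2 \<noteq> 0"
  shows "persp (- k) (persp k v) = v"
proof -
  have "1 + k * (v $ 2 / (1 - k * v $ 2)) = 1 / (1 - k * v $ 2)"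
    using assms by (simp add: field_simps)
  then show ?thesis
    using assms by (simp add: persp_def)
qed

text \<open>The denominator is affine in the point, so at \<open>x\<close> it is the convex
  combination \<open>W\<close> of its values \<open>A\<close> and \<open>B\<close> at the ends.
  Dividing by it only reweights: the coefficients become \<open>(1 - u) * A / W\<close> and
  \<open>u * B / W\<close>, which again sum to 1.\<close>

lemma persp_segment:
  assumes "1 - k * a $ 2 > 0" "1 - k * b $ 2 > 0" "x \<in> closed_segment a b"
  shows "persp k x \<in> closed_segment (persp k a) (persp k b)"
proof -
  obtain u where u: "0 \<le> u" "u \<le> 1" "x = (1 - u) *\<^sub>R a + u *\<^sub>R b"
    using assms(3) by (auto simp: in_segment)
  define A where "A = 1 - k * a $ 2"
  define B where "B = 1 - k * b $ 2"
  define W where "W = (1 - u) * A + u * B"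
  have pos: "A > 0" "B > 0" using assms by (auto simp: A_def B_def)
  have W: "W = 1 - k * x $ 2"
    by (simp add: W_def A_def B_def u algebra_simps)
  have "W > 0"
    unfolding W_def using u pos
    by (cases "u = 0") (simp_all add: add_nonneg_pos)
  have "W - u * B = (1 - u) * A"
    by (simp add: W_def)
  with \<open>W > 0\<close> have 1: "1 - u * B / W = (1 - u) * A / W"
    by (metis diff_divide_distrib divide_self less_irrefl)
  have "persp k x = (1 - u * B / W) *\<^sub>R persp k a + (u * B / W) *\<^sub>R persp k b"
    unfolding 1 persp_def W[symmetric] A_def[symmetric] B_def[symmetric] using pos
    by (simp add: u(3) scaleR_add_right)
  moreover have "0 \<le> u * B / W" "u * B / W \<le> 1"
    using u pos \<open>W > 0\<close> by (simp_all add: W_def)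
  ultimately show ?thesis
    by (auto simp: in_segment)
qed

lemma lb_isomorphic_strip_half_plane:
  "lb_isomorphic (betw_structure open_strip) (betw_structure open_half_plane)"
proof -
  have bij: "bij_betw (persp 1) open_strip open_half_plane"
  proof (rule bij_betwI[where g = "persp (- 1)"])
    show "persp 1 \<in> open_strip \<rightarrow> open_half_plane"
      by (auto simp: persp_def open_strip_def open_half_plane_def)
    show "persp (- 1) \<in> open_half_plane \<rightarrow> open_strip"
      by (auto simp: persp_def open_strip_def open_half_plane_def)
    show "persp (- 1) (persp 1 v) = v" if "v \<in> open_strip" for v
      using that persp_inverse[of 1 v] by (simp add: open_strip_def)
    show "persp 1 (persp (- 1) v) = v" if "v \<in> open_half_plane" for v
      using that persp_inverse[of "- 1" v] by (simp add: open_half_plane_def)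
  qed
  \<comment> \<open>Both directions use \<open>persp_segment\<close>, the converse for the inverse
    map; the denominators are positive on the strip and on the half-plane respectively.\<close>
  have "x \<in> closed_segment a b \<longleftrightarrow> persp 1 x \<in> closed_segment (persp 1 a) (persp 1 b)"
    if K: "a \<in> open_strip" "x \<in> open_strip" "b \<in> open_strip" for a x b
  proof
    assume "x \<in> closed_segment a b"
    then show "persp 1 x \<in> closed_segment (persp 1 a) (persp 1 b)"
      using K by (intro persp_segment) (auto simp: open_strip_def)
  next
    assume seg: "persp 1 x \<in> closed_segment (persp 1 a) (persp 1 b)"
    have H: "persp 1 a \<in> open_half_plane" "persp 1 b \<in> open_half_plane"
      using K bij by (auto simp: bij_betw_def)
    have "persp (- 1) (persp 1 x) \<in> closed_segment (persp (- 1) (persp 1 a)) (persp (- 1) (persp 1 b))"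
      using H by (intro persp_segment seg) (simp_all add: open_half_plane_def)
    then show "x \<in> closed_segment a b"
      using K by (simp add: persp_inverse open_strip_def)
  qed
  with bij show ?thesis
    unfolding lb_isomorphic_def by (intro exI[of _ "persp 1"]) (simp add: betw_structure_def)
qed

theorem proposition10p5:
  "(betw_structure (UNIV :: (real ^ 2) set) \<Turnstile> pi_sentence \<^bold>\<and> phi_sentence) \<and>
   (betw_structure open_strip \<Turnstile> \<^bold>\<not> pi_sentence \<^bold>\<and> phi_sentence) \<and>
   (betw_structure open_unit_disk \<Turnstile> \<^bold>\<not> pi_sentence \<^bold>\<and> \<^bold>\<not> phi_sentence) \<and>
   lb_isomorphic (betw_structure open_strip) (betw_structure open_half_plane) \<and>
   \<not> elementarily_equivalent (betw_structure (UNIV :: (real ^ 2) set)) (betw_structure open_strip) \<and>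
   \<not> elementarily_equivalent (betw_structure (UNIV :: (real ^ 2) set)) (betw_structure open_unit_disk) \<and>
   \<not> elementarily_equivalent (betw_structure open_strip) (betw_structure open_unit_disk) \<and>
   \<not> elementarily_equivalent (betw_structure (UNIV :: (real ^ 2) set)) (betw_structure open_half_plane) \<and>
   \<not> elementarily_equivalent (betw_structure open_half_plane) (betw_structure open_unit_disk)"
proof -
  let ?P = "betw_structure (UNIV :: (real ^ 2) set)" and ?S = "betw_structure open_strip"
    and ?D = "betw_structure open_unit_disk" and ?H = "betw_structure open_half_plane"
  have "vector [0, 1/2] \<in> open_strip"
    by (simp add: open_strip_def)
  then have ne: "univ ?S \<noteq> {}" "univ ?D \<noteq> {}"
    by (auto simp: betw_structure_def open_unit_disk_def)
  have P: "?P \<Turnstile> pi_sentence" "?P \<Turnstile> phi_sentence"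
    using models_pi_plane models_phi_horizontal_lines[of 0 1 UNIV] by auto
  \<comment> \<open>Any two heights strictly between 0 and 1 would serve.\<close>
  have S: "\<not> (?S \<Turnstile> pi_sentence)" "?S \<Turnstile> phi_sentence"
    by (rule not_models_pi_strip, rule models_phi_horizontal_lines[of "1/3" "2/3"])
      (auto simp: open_strip_def)
  have D: "\<not> (?D \<Turnstile> pi_sentence)" "\<not> (?D \<Turnstile> phi_sentence)"
    using not_models_pi_disk not_models_phi_bounded_open[of open_unit_disk]
    by (auto simp: open_unit_disk_def)
  have H: "\<not> (?H \<Turnstile> pi_sentence)" "?H \<Turnstile> phi_sentence"
    using S sentence_pi_phi lb_isomorphic_models_iff[OF lb_isomorphic_strip_half_plane _ ne(1)]
    by blast+
  show ?thesis
    unfolding elementarily_equivalent_def models_conj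
    using P S D H ne sentence_pi_phi lb_isomorphic_strip_half_plane
    by (auto simp: models_not_sentence)
qed

end
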